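(* Every high Turing degree contains sets $A$ and $B$ such that $A\le_{uT(tu)}B$.
   Context: "Recursive" means computable. Sets are subsets of $\omega$, identified with elements of $\{0,1\}^\omega$; $A\upharpoonright n=A(0)\cdots A(n-1)$. A Turing degree is high if its elements $B$ satisfy $B'\ge_T\emptyset''$. An order function is a recursive nondecreasing unbounded function $h:\omega\to\omega$. A function $g$ is dominated by $f$ if $g(n)\le f(n)$ for all but finitely many $n$. Use: if $\Phi$ is a Turing reduction with $\Phi^B=A$, where before computing $\Phi^B(n)$ the machine first computes $\Phi^B(m)$ for all $m<n$, then the use function is $\varphi(n)=m+1$ where $m$ is the largest number queried while computing $A\upharpoonright n$ (and $0$ if there are no queries). $A\le_{uT(tu)}B$ means: there is a Turing reduction $\Phi^B=A$ whose use function is dominated by every order function. *)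

theory Defs
  imports "HOL-Library.Nat_Bijection"
begin

section \<open>Oracle computation\<close>

text \<open>
  Programs for the unary partial functions on the natural numbers that are recursive relative
  to an oracle set. Several arguments are packed into one by \<^const>\<open>prod_encode\<close>, which is a
  bijection, so no arities are needed; the identity is \<open>PairP FstP SndP\<close>.
\<close>

datatype prog =
    ZeroP
  | SuccP
  | FstP
  | SndP
  | OracleP
  | PairP prog prog
  | CompP prog prog
  | PrecP prog prog
  | MuP prog

text \<open>
  \<open>run B p x y qs\<close>: with oracle \<open>B\<close>, program \<open>p\<close> halts on input \<open>x\<close> with output \<open>y\<close>, and \<open>qs\<close> is the
  list of all numbers that the oracle was asked about during this computation, in order.
  \<open>MuP p\<close>, on input \<open>(a, m)\<close>, searches for the least \<open>n \<ge> m\<close> such that \<open>p\<close> outputs 0 on \<open>(a, n)\<close>;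
  it diverges if \<open>p\<close> diverges on some \<open>(a, k)\<close> met before such an \<open>n\<close>.
\<close>

inductive run :: "nat set \<Rightarrow> prog \<Rightarrow> nat \<Rightarrow> nat \<Rightarrow> nat list \<Rightarrow> bool" for B :: "nat set" where
  Zero: "run B ZeroP x 0 []"
| Succ: "run B SuccP x (Suc x) []"
| Fst: "run B FstP (prod_encode (a, b)) a []"
| Snd: "run B SndP (prod_encode (a, b)) b []"
| Oracle: "run B OracleP x (of_bool (x \<in> B)) [x]"
| Pair: "run B p x y qs \<Longrightarrow> run B q x z rs \<Longrightarrow> run B (PairP p q) x (prod_encode (y, z)) (qs @ rs)"
| Comp: "run B q x y qs \<Longrightarrow> run B p y z rs \<Longrightarrow> run B (CompP p q) x z (qs @ rs)"
| Prec_0: "run B p a y qs \<Longrightarrow> run B (PrecP p q) (prod_encode (a, 0)) y qs"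
| Prec_Suc: "run B (PrecP p q) (prod_encode (a, n)) y qs \<Longrightarrow>
    run B q (prod_encode (a, prod_encode (n, y))) z rs \<Longrightarrow>
    run B (PrecP p q) (prod_encode (a, Suc n)) z (qs @ rs)"
| Mu_stop: "run B p (prod_encode (a, m)) 0 qs \<Longrightarrow> run B (MuP p) (prod_encode (a, m)) m qs"
| Mu_step: "run B p (prod_encode (a, m)) (Suc v) qs \<Longrightarrow>
    run B (MuP p) (prod_encode (a, Suc m)) n rs \<Longrightarrow>
    run B (MuP p) (prod_encode (a, m)) n (qs @ rs)"

lemma run_deterministic:
  assumes "run B p x y qs" and "run B p x y' qs'"
  shows "y = y' \<and> qs = qs'"
  using assms
proof (induction arbitrary: y' qs' rule: run.induct)
  case (Pair p x y qs q z rs)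
  from Pair.prems show ?case
    by (cases rule: run.cases) (use Pair.IH in blast)+
next
  case (Comp q x y qs p z rs)
  from Comp.prems show ?case
    by (cases rule: run.cases) (use Comp.IH in blast)+
next
  case (Prec_0 p a y qs q)
  from Prec_0.prems show ?case
    by (cases rule: run.cases) (use Prec_0.IH in \<open>auto simp: prod_encode_eq\<close>)
next
  case (Prec_Suc p q a n y qs z rs)
  from Prec_Suc.prems show ?case
    by (cases rule: run.cases) (auto simp: prod_encode_eq dest!: Prec_Suc.IH)
next
  case (Mu_stop p a m qs)
  from Mu_stop.prems show ?case
    by (cases rule: run.cases) (insert Mu_stop.IH, (fastforce simp: prod_encode_eq)+)
next
  case (Mu_step p a m v qs n rs)
  from Mu_step.prems show ?case
    by (cases rule: run.cases) (insert Mu_step.IH, (fastforce simp: prod_encode_eq)+)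
qed (erule run.cases; simp add: prod_encode_eq)+


section \<open>Turing reducibility, degrees and the jump\<close>

text \<open>\<open>reduction p B A\<close>: the Turing reduction \<open>p\<close> satisfies \<open>p\<^sup>B = A\<close>.\<close>

definition reduction :: "prog \<Rightarrow> nat set \<Rightarrow> nat set \<Rightarrow> bool" where
  "reduction p B A \<longleftrightarrow> (\<forall>n. \<exists>qs. run B p n (of_bool (n \<in> A)) qs)"

definition turing_le :: "nat set \<Rightarrow> nat set \<Rightarrow> bool" (infix "\<le>\<^sub>T" 50) where
  "A \<le>\<^sub>T B \<longleftrightarrow> (\<exists>p. reduction p B A)"

definition turing_equiv :: "(nat set \<times> nat set) set" where
  "turing_equiv = {(A, B). A \<le>\<^sub>T B \<and> B \<le>\<^sub>T A}"

primrec replace_oracle :: "prog \<Rightarrow> prog \<Rightarrow> prog" where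
  "replace_oracle r ZeroP = ZeroP"
| "replace_oracle r SuccP = SuccP"
| "replace_oracle r FstP = FstP"
| "replace_oracle r SndP = SndP"
| "replace_oracle r OracleP = r"
| "replace_oracle r (PairP p q) = PairP (replace_oracle r p) (replace_oracle r q)"
| "replace_oracle r (CompP p q) = CompP (replace_oracle r p) (replace_oracle r q)"
| "replace_oracle r (PrecP p q) = PrecP (replace_oracle r p) (replace_oracle r q)"
| "replace_oracle r (MuP p) = MuP (replace_oracle r p)"

lemma run_replace_oracle:
  assumes "run C p x y qs" and "reduction r B C"
  shows "\<exists>rs. run B (replace_oracle r p) x y rs"
  using assms
proof (induction rule: run.induct)
  case (Oracle x)
  then show ?case by (auto simp: reduction_def)
qed (fastforce intro: run.intros)+

lemma equiv_turing_equiv: "equiv UNIV turing_equiv"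
proof (rule equivI)
  have "reduction OracleP A A" for A
    unfolding reduction_def using run.Oracle by blast
  then show "refl turing_equiv"
    by (auto simp: refl_on_def turing_equiv_def turing_le_def)
  show "sym turing_equiv"
    by (auto simp: sym_def turing_equiv_def)
  have "A \<le>\<^sub>T C" if "A \<le>\<^sub>T B" "B \<le>\<^sub>T C" for A B C
  proof -
    from that obtain p r where p: "reduction p B A" and r: "reduction r C B"
      by (auto simp: turing_le_def)
    have "reduction (replace_oracle r p) C A"
      unfolding reduction_def using p run_replace_oracle[OF _ r] by (meson reduction_def)
    then show ?thesis by (auto simp: turing_le_def)
  qed
  then show "trans turing_equiv"
    unfolding trans_def turing_equiv_def by blast
qed simp

definition turing_degrees :: "nat set set set" where
  "turing_degrees = UNIV // turing_equiv"

text \<open>An effective Goedel numbering of programs.\<close>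

primrec prog_encode :: "prog \<Rightarrow> nat" where
  "prog_encode ZeroP = 0"
| "prog_encode SuccP = 1"
| "prog_encode FstP = 2"
| "prog_encode SndP = 3"
| "prog_encode OracleP = 4"
| "prog_encode (PairP p q) = 5 + 4 * prod_encode (prog_encode p, prog_encode q)"
| "prog_encode (CompP p q) = 6 + 4 * prod_encode (prog_encode p, prog_encode q)"
| "prog_encode (PrecP p q) = 7 + 4 * prod_encode (prog_encode p, prog_encode q)"
| "prog_encode (MuP p) = 8 + 4 * prog_encode p"

lemma bij_prog_encode: "bij prog_encode"
proof (rule bijI)
  have "prog_encode p = prog_encode q \<Longrightarrow> p = q" for p q
  proof (induction p arbitrary: q)
    case ZeroP then show ?case by (cases q) auto
  next
    case SuccP then show ?case by (cases q) auto
  next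
    case FstP then show ?case by (cases q) auto
  next
    case SndP then show ?case by (cases q) auto
  next
    case OracleP then show ?case by (cases q) auto
  next
    case (PairP p1 p2) from PairP.prems show ?case
      by (cases q) (use PairP.IH in \<open>auto simp: prod_encode_eq, presburger+\<close>)
  next
    case (CompP p1 p2) from CompP.prems show ?case
      by (cases q) (use CompP.IH in \<open>auto simp: prod_encode_eq, presburger+\<close>)
  next
    case (PrecP p1 p2) from PrecP.prems show ?case
      by (cases q) (use PrecP.IH in \<open>auto simp: prod_encode_eq, presburger+\<close>)
  next
    case (MuP p) from MuP.prems show ?case
      by (cases q) (use MuP.IH in \<open>auto simp: prod_encode_eq, presburger+\<close>)
  qed
  then show "inj prog_encode" by (simp add: inj_on_def)
  have "\<exists>p. prog_encode p = e" for e
  proof (induction e rule: less_induct)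
    case (less e)
    show ?case
    proof (cases "e < 5")
      case True
      then have "e = 0 \<or> e = 1 \<or> e = 2 \<or> e = 3 \<or> e = 4" by linarith
      then show ?thesis
        using prog_encode.simps(1-5) by metis
    next
      case False
      define k where "k = (e - 5) div 4"
      obtain a b where ab: "k = prod_encode (a, b)"
        by (metis prod_decode_inverse surj_pair)
      have e: "e = 5 + 4 * k \<or> e = 6 + 4 * k \<or> e = 7 + 4 * k \<or> e = 8 + 4 * k"
        using False unfolding k_def by presburger
      then have "k < e" by linarith
      moreover have "a \<le> k" "b \<le> k"
        unfolding ab by (simp_all add: le_prod_encode_1 le_prod_encode_2)
      ultimately obtain p q r where "prog_encode p = a" "prog_encode q = b" "prog_encode r = k"
        using less.IH by (meson le_less_trans)
      then show ?thesis
        using e ab prog_encode.simps(6-9) by metis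
    qed
  qed
  then show "surj prog_encode" by (metis surjI)
qed

definition jump :: "nat set \<Rightarrow> nat set" where
  "jump B = {prog_encode p | p. \<exists>y qs. run B p (prog_encode p) y qs}"

definition high :: "nat set set \<Rightarrow> bool" where
  "high d \<longleftrightarrow> (\<forall>B\<in>d. jump (jump {}) \<le>\<^sub>T jump B)"


section \<open>Order functions and reductions with tiny use\<close>

text \<open>Recursive functions are those computable with the empty oracle.\<close>

definition recursive :: "(nat \<Rightarrow> nat) \<Rightarrow> bool" where
  "recursive h \<longleftrightarrow> (\<exists>p. \<forall>n. \<exists>qs. run {} p n (h n) qs)"

definition order_function :: "(nat \<Rightarrow> nat) \<Rightarrow> bool" where
  "order_function h \<longleftrightarrow> recursive h \<and> mono h \<and> (\<forall>k. \<exists>n. k < h n)"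

definition dominated_by :: "(nat \<Rightarrow> nat) \<Rightarrow> (nat \<Rightarrow> nat) \<Rightarrow> bool" where
  "dominated_by g f \<longleftrightarrow> (\<forall>\<^sub>F n in sequentially. g n \<le> f n)"

text \<open>
  The numbers queried while computing the first \<open>n\<close> values. Taking all inputs \<open>m < n\<close> together
  implements the convention that, before treating an input, the machine first computes its
  outputs on all smaller inputs.
\<close>

definition queries :: "prog \<Rightarrow> nat set \<Rightarrow> nat \<Rightarrow> nat set" where
  "queries p B n = {q. \<exists>m<n. \<exists>y qs. run B p m y qs \<and> q \<in> set qs}"

lemma finite_queries: "finite (queries p B n)"
proof -
  have "finite {q. \<exists>y qs. run B p m y qs \<and> q \<in> set qs}" for m
  proof (cases "\<exists>y qs. run B p m y qs")
    case True
    then obtain y qs where "run B p m y qs" by blast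
    then have "{q. \<exists>y qs. run B p m y qs \<and> q \<in> set qs} \<subseteq> set qs"
      using run_deterministic by blast
    then show ?thesis by (rule finite_subset) simp
  qed simp
  moreover have "queries p B n = (\<Union>m<n. {q. \<exists>y qs. run B p m y qs \<and> q \<in> set qs})"
    by (auto simp: queries_def)
  ultimately show ?thesis by simp
qed

definition use_function :: "prog \<Rightarrow> nat set \<Rightarrow> nat \<Rightarrow> nat" where
  "use_function p B n = (if queries p B n = {} then 0 else Max (queries p B n) + 1)"

definition uT_tu_le :: "nat set \<Rightarrow> nat set \<Rightarrow> bool" (infix "\<le>\<^sub>u\<^sub>T\<^sub>t\<^sub>u" 50) where
  "A \<le>\<^sub>u\<^sub>T\<^sub>t\<^sub>u B \<longleftrightarrow>
    (\<exists>p. reduction p B A \<and> (\<forall>h. order_function h \<longrightarrow> dominated_by (use_function p B) h))"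

end

theory Submission imports Defs begin

text \<open>
  Let \<open>D\<close> be a set of high degree. As in Martin's theorem, \<open>D\<close> computes a set \<open>W\<close> of pairs \<open>(e, j)\<close> such
  that program \<open>e\<close> halts on \<open>j\<close>, and such that \<open>W\<close> contains almost all \<open>(e, j)\<close> when \<open>e\<close> is total. The set
  \<open>B\<close> codes \<open>W\<close> and \<open>D\<close>. From the first \<open>O(k\<^sup>2)\<close> bits of \<open>B\<close> one can compute the outputs of all
  programs \<open>e < k\<close> on \<open>k\<close> that are recorded in \<open>W\<close>, hence a strictly increasing sequence \<open>a\<close> that
  dominates every recursive function and whose parities code \<open>D\<close>. For \<open>A = range a\<close>, deciding
  \<open>n \<in> A\<close> takes only the values \<open>a 0, ..., a k\<close> with \<open>k\<close> least such that \<open>n \<le> a k\<close>, and this \<open>k\<close> grows more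
  slowly than every order function; moreover \<open>D \<le>\<^sub>T A \<le>\<^sub>T B \<le>\<^sub>T D\<close>.
\<close>

section \<open>Computable functions with bounded queries\<close>

abbreviation pfst :: "nat \<Rightarrow> nat" where "pfst x \<equiv> fst (prod_decode x)"
abbreviation psnd :: "nat \<Rightarrow> nat" where "psnd x \<equiv> snd (prod_decode x)"

text \<open>\<open>Q x\<close> bounds the oracle queries made on input \<open>x\<close>. Carrying
  the bound along lets the use of the final reduction be read off from the closure lemmas.
  \<open>UNIV\<close> gives ordinary relative computability, the empty set computability without
  queries.\<close>

definition computable :: "nat set \<Rightarrow> (nat \<Rightarrow> nat set) \<Rightarrow> (nat \<Rightarrow> nat) \<Rightarrow> bool" where
  "computable B Q f \<longleftrightarrow> (\<exists>p. \<forall>x. \<exists>qs. run B p x (f x) qs \<and> set qs \<subseteq> Q x)"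

abbreviation decidable :: "nat set \<Rightarrow> (nat \<Rightarrow> nat set) \<Rightarrow> (nat \<Rightarrow> bool) \<Rightarrow> bool" where
  "decidable B Q P \<equiv> computable B Q (\<lambda>x. of_bool (P x))"

lemma run_FstP: "run B FstP x (pfst x) []"
  using run.Fst[of B "pfst x" "psnd x"] by simp

lemma run_SndP: "run B SndP x (psnd x) []"
  using run.Snd[of B "pfst x" "psnd x"] by simp

lemma computable_compose:
  assumes "computable B R f" and "computable B Q g" and "\<And>x. R (g x) \<subseteq> Q x"
  shows "computable B Q (\<lambda>x. f (g x))"
proof -
  obtain p where p: "\<And>x. \<exists>qs. run B p x (f x) qs \<and> set qs \<subseteq> R x"
    using assms(1) unfolding computable_def by blast
  obtain q where q: "\<And>x. \<exists>qs. run B q x (g x) qs \<and> set qs \<subseteq> Q x"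
    using assms(2) unfolding computable_def by blast
  have "\<exists>qs. run B (CompP p q) x (f (g x)) qs \<and> set qs \<subseteq> Q x" for x
  proof -
    obtain qs rs where "run B q x (g x) qs" "set qs \<subseteq> Q x" "run B p (g x) (f (g x)) rs" "set rs \<subseteq> R (g x)"
      using p q by meson
    then show ?thesis
      using run.Comp[of B q x "g x" qs p "f (g x)" rs] assms(3)[of x] by (intro exI[of _ "qs @ rs"]) auto
  qed
  then show ?thesis unfolding computable_def by blast
qed

lemma computable_id: "computable B Q (\<lambda>x. x)"
proof -
  have "run B (PairP FstP SndP) x x []" for x
    using run.Pair[OF run_FstP run_SndP, of B x] by simp
  then show ?thesis unfolding computable_def by (metis empty_set empty_subsetI)
qed

lemma computable_apply:
  "computable B (\<lambda>_. {}) f \<Longrightarrow> computable B Q g \<Longrightarrow> computable B Q (\<lambda>x. f (g x))"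
  by (rule computable_compose) auto

lemma computable_Suc: "computable B Q f \<Longrightarrow> computable B Q (\<lambda>x. Suc (f x))"
  by (rule computable_apply) (auto simp: computable_def intro!: exI run.Succ)

lemma computable_pfst: "computable B Q f \<Longrightarrow> computable B Q (\<lambda>x. pfst (f x))"
  by (rule computable_apply[of _ pfst]) (auto simp: computable_def intro!: exI run_FstP)

lemma computable_psnd: "computable B Q f \<Longrightarrow> computable B Q (\<lambda>x. psnd (f x))"
  by (rule computable_apply[of _ psnd]) (auto simp: computable_def intro!: exI run_SndP)

primrec const_prog :: "nat \<Rightarrow> prog" where
  "const_prog 0 = ZeroP"
| "const_prog (Suc n) = CompP SuccP (const_prog n)"

lemma run_const_prog: "run B (const_prog n) x n []"
proof (induction n)
  case (Suc n)
  show ?case using run.Comp[OF Suc run.Succ] by simp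
qed (simp add: run.Zero)

lemma computable_const: "computable B Q (\<lambda>x. c)"
  unfolding computable_def using run_const_prog by (metis empty_set empty_subsetI)

lemma computable_pair:
  assumes "computable B Q f" and "computable B Q g"
  shows "computable B Q (\<lambda>x. prod_encode (f x, g x))"
proof -
  obtain p where p: "\<And>x. \<exists>qs. run B p x (f x) qs \<and> set qs \<subseteq> Q x"
    using assms(1) unfolding computable_def by blast
  obtain q where q: "\<And>x. \<exists>qs. run B q x (g x) qs \<and> set qs \<subseteq> Q x"
    using assms(2) unfolding computable_def by blast
  have "\<exists>qs. run B (PairP p q) x (prod_encode (f x, g x)) qs \<and> set qs \<subseteq> Q x" for x
  proof -
    obtain qs rs where "run B p x (f x) qs" "set qs \<subseteq> Q x" "run B q x (g x) rs" "set rs \<subseteq> Q x"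
      using p q by meson
    then show ?thesis
      using run.Pair[of B p x "f x" qs q "g x" rs] by (intro exI[of _ "qs @ rs"]) auto
  qed
  then show ?thesis unfolding computable_def by blast
qed

text \<open>Reduces closure under a binary operation to one query-free program on packed pairs.
  Recursions defining \<open>F\<close> can then be handled under a constant bound and transferred to
  every \<open>Q\<close>.\<close>

lemma computable_apply2:
  assumes "computable B (\<lambda>_. {}) (\<lambda>z. F (pfst z) (psnd z))" "computable B Q f" "computable B Q g"
  shows "computable B Q (\<lambda>x. F (f x) (g x))"
  using computable_apply[OF assms(1) computable_pair[OF assms(2,3)]] by simp

text \<open>The step program is run only on the true intermediate values with
  \<open>i < n x\<close>, so only its queries there have to lie in \<open>Q x\<close>.\<close>

lemma computable_rec_within:
  assumes b: "computable B Q b"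
    and s: "computable B R (\<lambda>z. s (pfst z) (pfst (psnd z)) (psnd (psnd z)))"
    and n: "computable B Q n"
    and R: "\<And>x i. i < n x \<Longrightarrow> R (prod_encode (x, prod_encode (i, rec_nat (b x) (s x) i))) \<subseteq> Q x"
  shows "computable B Q (\<lambda>x. rec_nat (b x) (s x) (n x))"
proof -
  obtain p where p: "\<And>x. \<exists>qs. run B p x (b x) qs \<and> set qs \<subseteq> Q x"
    using b unfolding computable_def by blast
  obtain q where q: "\<And>z. \<exists>qs. run B q z (s (pfst z) (pfst (psnd z)) (psnd (psnd z))) qs \<and> set qs \<subseteq> R z"
    using s unfolding computable_def by blast
  have rec: "\<exists>qs. run B (PrecP p q) (prod_encode (x, i)) (rec_nat (b x) (s x) i) qs \<and> set qs \<subseteq> Q x"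
    if "i \<le> n x" for x i
    using that
  proof (induction i)
    case 0
    then show ?case using p[of x] run.Prec_0 by fastforce
  next
    case (Suc i)
    let ?z = "prod_encode (x, prod_encode (i, rec_nat (b x) (s x) i))"
    obtain qs where "run B (PrecP p q) (prod_encode (x, i)) (rec_nat (b x) (s x) i) qs" "set qs \<subseteq> Q x"
      using Suc by auto
    moreover obtain rs where "run B q ?z (rec_nat (b x) (s x) (Suc i)) rs" "set rs \<subseteq> R ?z"
      using q[of ?z] by auto
    ultimately show ?case
      using run.Prec_Suc[of B p q x i _ qs _ rs] R[of i x] Suc.prems by (intro exI[of _ "qs @ rs"]) auto
  qed
  obtain m where m: "\<And>x. \<exists>qs. run B m x (prod_encode (x, n x)) qs \<and> set qs \<subseteq> Q x"
    using computable_pair[OF computable_id n] unfolding computable_def by blast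
  have "\<exists>qs. run B (CompP (PrecP p q) m) x (rec_nat (b x) (s x) (n x)) qs \<and> set qs \<subseteq> Q x" for x
  proof -
    obtain qs rs where "run B m x (prod_encode (x, n x)) qs" "set qs \<subseteq> Q x"
      "run B (PrecP p q) (prod_encode (x, n x)) (rec_nat (b x) (s x) (n x)) rs" "set rs \<subseteq> Q x"
      using m rec[OF order_refl] by meson
    then show ?thesis
      using run.Comp[of B m x _ qs "PrecP p q" _ rs] by (intro exI[of _ "qs @ rs"]) auto
  qed
  then show ?thesis unfolding computable_def by blast
qed

lemma computable_rec:
  assumes "computable B (\<lambda>_. S) b"
    and "computable B (\<lambda>_. S) (\<lambda>z. s (pfst z) (pfst (psnd z)) (psnd (psnd z)))"
    and "computable B (\<lambda>_. S) n"
  shows "computable B (\<lambda>_. S) (\<lambda>x. rec_nat (b x) (s x) (n x))"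
  using assms by (rule computable_rec_within) auto

text \<open>The search tests no candidate beyond the least witness, so later candidates put no
  constraint on \<open>Q x\<close>.\<close>

lemma computable_Least_within:
  assumes P: "decidable B R (\<lambda>z. P (pfst z) (psnd z))"
    and ex: "\<And>x. \<exists>k. P x k"
    and R: "\<And>x k. k \<le> (LEAST k. P x k) \<Longrightarrow> R (prod_encode (x, k)) \<subseteq> Q x"
  shows "computable B Q (\<lambda>x. LEAST k. P x k)"
proof -
  \<comment> \<open>\<open>MuP\<close> stops at output 0, so the truth value is negated first; the
    recursion with base 1 and constant step 0 exchanges 0 and 1.\<close>
  have "computable B R (\<lambda>z. rec_nat 1 (\<lambda>_ _. 0) (of_bool (P (pfst z) (psnd z))))"
    by (rule computable_rec_within[where R = "\<lambda>_. {}"]) (auto intro: computable_const P)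
  also have "(\<lambda>z. rec_nat 1 (\<lambda>_ _. 0) (of_bool (P (pfst z) (psnd z)))) =
      (\<lambda>z. of_bool (\<not> P (pfst z) (psnd z)) :: nat)"
    by auto
  finally obtain p where p:
    "\<And>z. \<exists>qs. run B p z (of_bool (\<not> P (pfst z) (psnd z))) qs \<and> set qs \<subseteq> R z"
    unfolding computable_def by blast
  \<comment> \<open>The induction is on the distance \<open>d\<close> to the least witness
    \<open>L\<close>, since a search starting at \<open>m\<close> depends on the one starting at
    \<open>Suc m\<close>.\<close>
  have search: "\<exists>qs. run B (MuP p) (prod_encode (x, L - d)) L qs \<and> set qs \<subseteq> Q x"
    if "L = (LEAST k. P x k)" "d \<le> L" for x L d
    using that(2)
  proof (induction d)
    case 0
    have "P x L" using that(1) ex LeastI_ex by metis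
    then show ?case
      using p[of "prod_encode (x, L)"] R[of L x] that(1) run.Mu_stop by fastforce
  next
    case (Suc d)
    let ?k = "L - Suc d"
    have "\<not> P x ?k" using that(1) Suc.prems by (metis not_less_Least diff_less zero_less_Suc less_le_trans)
    then obtain qs where qs: "run B p (prod_encode (x, ?k)) (Suc 0) qs" "set qs \<subseteq> R (prod_encode (x, ?k))"
      using p[of "prod_encode (x, ?k)"] by auto
    obtain rs where "run B (MuP p) (prod_encode (x, L - d)) L rs" "set rs \<subseteq> Q x"
      using Suc by auto
    moreover have "Suc ?k = L - d" using Suc.prems by simp
    ultimately show ?case
      using run.Mu_step[OF qs(1), of L rs] qs(2) R[of ?k x] that(1) by (intro exI[of _ "qs @ rs"]) auto
  qed
  have "\<exists>qs. run B (CompP (MuP p) (PairP (PairP FstP SndP) ZeroP)) x (LEAST k. P x k) qs \<and> set qs \<subseteq> Q x" for x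
  proof -
    let ?L = "LEAST k. P x k"
    obtain qs where "run B (MuP p) (prod_encode (x, 0)) ?L qs" "set qs \<subseteq> Q x"
      using search[of ?L x ?L] by auto
    moreover have "run B (PairP (PairP FstP SndP) ZeroP) x (prod_encode (x, 0)) []"
      using run.Pair[OF run.Pair[OF run_FstP run_SndP] run.Zero, of B x] by simp
    ultimately show ?thesis
      using run.Comp by fastforce
  qed
  then show ?thesis unfolding computable_def by blast
qed

lemma computable_Least:
  assumes "decidable B (\<lambda>_. S) (\<lambda>z. P (pfst z) (psnd z))" and "\<And>x. \<exists>k. P x k"
  shows "computable B (\<lambda>_. S) (\<lambda>x. LEAST k. P x k)"
  using assms by (rule computable_Least_within) auto

section \<open>Closure under arithmetic, logic, iteration and finite sums\<close>

named_theorems computable_intros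

lemmas [computable_intros] =
  computable_id computable_const computable_Suc computable_pfst computable_psnd computable_pair
  computable_rec computable_Least

lemma computable_add [computable_intros]:
  assumes "computable B Q f" "computable B Q g"
  shows "computable B Q (\<lambda>x. f x + g x)"
proof (rule computable_apply2[OF _ assms])
  have "m + n = rec_nat m (\<lambda>_. Suc) n" for m n by (induction n) auto
  then show "computable B (\<lambda>_. {}) (\<lambda>z. pfst z + psnd z)"
    by (auto intro!: computable_intros)
qed

lemma computable_diff [computable_intros]:
  assumes "computable B Q f" "computable B Q g"
  shows "computable B Q (\<lambda>x. f x - g x)"
proof (rule computable_apply2[OF _ assms])
  have pred: "n - 1 = rec_nat 0 (\<lambda>i _. i) n" for n by (cases n) auto
  have "m - n = rec_nat m (\<lambda>_ r. rec_nat 0 (\<lambda>i _. i) r) n" for m n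
    by (induction n) (auto simp flip: pred)
  then show "computable B (\<lambda>_. {}) (\<lambda>z. pfst z - psnd z)"
    by (auto intro!: computable_intros)
qed

lemma computable_mult [computable_intros]:
  assumes "computable B Q f" "computable B Q g"
  shows "computable B Q (\<lambda>x. f x * g x)"
proof (rule computable_apply2[OF _ assms])
  have "m * n = rec_nat 0 (\<lambda>_ r. m + r) n" for m n by (induction n) auto
  then show "computable B (\<lambda>_. {}) (\<lambda>z. pfst z * psnd z)"
    by (auto intro!: computable_intros)
qed

lemma decidable_eq0:
  assumes "computable B Q f" shows "decidable B Q (\<lambda>x. f x = 0)"
proof -
  have "(\<lambda>x. of_bool (f x = 0)) = (\<lambda>x. 1 - f x)" by auto
  then show ?thesis using assms by (auto intro!: computable_intros)
qed

lemma decidable_not [computable_intros]: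
  "decidable B Q P \<Longrightarrow> decidable B Q (\<lambda>x. \<not> P x)"
  using decidable_eq0[of B Q "\<lambda>x. of_bool (P x)"] by simp

lemma decidable_le [computable_intros]:
  assumes "computable B Q f" "computable B Q g" shows "decidable B Q (\<lambda>x. f x \<le> g x)"
  using decidable_eq0[OF computable_diff[OF assms]] by simp

lemma decidable_less [computable_intros]:
  assumes "computable B Q f" "computable B Q g" shows "decidable B Q (\<lambda>x. f x < g x)"
  using decidable_not[OF decidable_le[OF assms(2,1)]] by (simp add: not_le)

lemma decidable_conj [computable_intros]:
  assumes "decidable B Q P" "decidable B Q P'" shows "decidable B Q (\<lambda>x. P x \<and> P' x)"
  using computable_mult[OF assms] by (simp add: of_bool_conj)

lemma decidable_disj [computable_intros]:
  assumes "decidable B Q P" "decidable B Q P'" shows "decidable B Q (\<lambda>x. P x \<or> P' x)"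
  using decidable_not[OF decidable_conj[OF assms[THEN decidable_not]]] by simp

lemma decidable_eq [computable_intros]:
  assumes "computable B Q f" "computable B Q g" shows "decidable B Q (\<lambda>x. f x = g x)"
  using decidable_conj[OF decidable_le[OF assms] decidable_le[OF assms(2,1)]]
  by (simp add: eq_iff)

lemma computable_if [computable_intros]:
  assumes "decidable B Q P" "computable B Q f" "computable B Q g"
  shows "computable B Q (\<lambda>x. if P x then f x else g x)"
proof -
  have "(\<lambda>x. if P x then f x else g x) = (\<lambda>x. of_bool (P x) * f x + of_bool (\<not> P x) * g x)"
    by auto
  then show ?thesis using assms by (auto intro!: computable_intros)
qed

lemma decidable_if [computable_intros]:
  assumes "decidable B Q P" "decidable B Q P1" "decidable B Q P2"
  shows "decidable B Q (\<lambda>x. if P x then P1 x else P2 x)"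
  using computable_if[OF assms] by (simp add: if_distrib cong: if_cong)

text \<open>Remainder and quotient by 4 decode the four constructors of \<open>prog\<close> that
  have arguments.\<close>

lemma computable_mod4 [computable_intros]:
  assumes "computable B Q f" shows "computable B Q (\<lambda>x. f x mod 4)"
proof (rule computable_apply[OF _ assms, of "\<lambda>n. n mod 4"])
  have "n mod 4 = rec_nat 0 (\<lambda>_ r. if r = 3 then 0 else Suc r) n" for n :: nat
  proof (induction n)
    case (Suc n)
    show ?case by (simp add: Suc[symmetric] mod_Suc)
  qed simp
  then show "computable B (\<lambda>_. {}) (\<lambda>n. n mod 4)"
    by (auto intro!: computable_intros)
qed

lemma computable_div4 [computable_intros]:
  assumes "computable B Q f" shows "computable B Q (\<lambda>x. f x div 4)"
proof (rule computable_apply[OF _ assms, of "\<lambda>n. n div 4"])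
  have "n div 4 = (LEAST k. n < 4 * k + 4)" for n :: nat
    by (rule Least_equality[symmetric]) auto
  moreover have "\<exists>k. n < 4 * k + 4" for n :: nat
    by (rule exI[of _ n]) simp
  ultimately show "computable B (\<lambda>_. {}) (\<lambda>n. n div 4)"
    by (auto intro!: computable_intros)
qed

lemma decidable_odd [computable_intros]:
  assumes "computable B Q f" shows "decidable B Q (\<lambda>x. odd (f x))"
proof -
  have odd: "odd n \<longleftrightarrow> n mod 4 = 1 \<or> n mod 4 = 3" for n :: nat by presburger
  show ?thesis unfolding odd by (intro computable_intros assms)
qed

lemma computable_funpow [computable_intros]:
  assumes "computable B (\<lambda>_. S) (\<lambda>z. F (pfst z) (psnd z))"
    and "computable B (\<lambda>_. S) n" "computable B (\<lambda>_. S) g"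
  shows "computable B (\<lambda>_. S) (\<lambda>x. (F x ^^ n x) (g x))"
proof -
  have "(F x ^^ k) y = rec_nat y (\<lambda>_. F x) k" for x k y by (induction k) auto
  moreover have "computable B (\<lambda>_. S) (\<lambda>z. F (pfst z) (psnd (psnd z)))"
    using computable_compose[OF assms(1) computable_pair[OF computable_pfst[OF computable_id]
      computable_psnd[OF computable_psnd[OF computable_id]]]] by simp
  ultimately show ?thesis using assms(2,3) by (auto intro!: computable_intros)
qed

lemma computable_sum_within:
  assumes f: "computable B R (\<lambda>z. f (pfst z) (psnd z))" and n: "computable B Q n"
    and R: "\<And>x i. i < n x \<Longrightarrow> R (prod_encode (x, i)) \<subseteq> Q x"
  shows "computable B Q (\<lambda>x. \<Sum>i<n x. f x i)"
proof -
  have "(\<Sum>i<k. f x i) = rec_nat 0 (\<lambda>i r. r + f x i) k" for x k by (induction k) auto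
  moreover have "computable B (\<lambda>z. R (prod_encode (pfst z, pfst (psnd z)))) (\<lambda>z. f (pfst z) (pfst (psnd z)))"
    using computable_compose[OF f computable_pair[OF computable_pfst[OF computable_id]
      computable_pfst[OF computable_psnd[OF computable_id]]]] by simp
  then have "computable B Q (\<lambda>x. rec_nat 0 (\<lambda>i r. r + f x i) (n x))"
    using n R by (intro computable_rec_within[where R = "\<lambda>z. R (prod_encode (pfst z, pfst (psnd z)))"])
      (auto intro!: computable_intros)
  ultimately show ?thesis by simp
qed

lemma decidable_oracle: "decidable B (\<lambda>x. {x}) (\<lambda>x. x \<in> B)"
proof -
  have "run B OracleP x (of_bool (x \<in> B)) [x] \<and> set [x] \<subseteq> {x}" for x
    using run.Oracle by simp
  then show ?thesis unfolding computable_def by blast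
qed

lemma turing_le_iff_decidable: "A \<le>\<^sub>T B \<longleftrightarrow> decidable B (\<lambda>_. UNIV) (\<lambda>x. x \<in> A)"
  by (auto simp: turing_le_def reduction_def computable_def)

lemma recursive_iff_computable: "recursive h \<longleftrightarrow> computable {} (\<lambda>_. UNIV) h"
  by (auto simp: recursive_def computable_def)


section \<open>An abstract machine\<close>

text \<open>
  Oracles are presented to the machine as finite tables coded by iterated pairing. The entry 0
  means ``unknown'' and \<open>Suc b\<close> is the answer \<open>b\<close>; the machine loops on unknown queries, so that
  every halting computation is correct for every oracle extending the table.
\<close>

definition lookup :: "nat \<Rightarrow> nat \<Rightarrow> nat" where
  "lookup w x = pfst ((psnd ^^ x) w)"

text \<open>
  A state is a pair of a stack of tagged frames and a value, which the topmost frame consumes: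
  tag 0 runs a program on the value, tag 1 holds \<open>(q, x)\<close> and runs the second half \<open>q\<close> of a pair on \<open>x\<close>,
  tag 2 holds the left component of a pair, and tag 3 holds \<open>(p, x)\<close> for a search \<open>MuP p\<close> that is
  testing \<open>x\<close>. The empty stack 0 marks a halted machine.
\<close>

definition push :: "nat \<Rightarrow> nat \<Rightarrow> nat \<Rightarrow> nat" where
  "push t c K = Suc (prod_encode (prod_encode (t, c), K))"

text \<open>An unknown query recreates the current state, which is the intended loop. For
  \<open>PrecP\<close> with positive counter, the previous value \<open>y\<close> is computed first;
  the two tag 2 frames then build \<open>(n, y)\<close> and \<open>(a, (n, y))\<close>, the argument
  expected by the step program.\<close>

definition run_step :: "nat \<Rightarrow> nat \<Rightarrow> nat \<Rightarrow> nat \<Rightarrow> nat" where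
  "run_step w c v K = (
    if c = 0 then prod_encode (K, 0)
    else if c = 1 then prod_encode (K, Suc v)
    else if c = 2 then prod_encode (K, pfst v)
    else if c = 3 then prod_encode (K, psnd v)
    else if c = 4 then
      if lookup w v = 0 then prod_encode (push 0 c K, v) else prod_encode (K, lookup w v - 1)
    else if (c - 5) mod 4 = 0 then
      prod_encode (push 0 (pfst ((c - 5) div 4)) (push 1 (prod_encode (psnd ((c - 5) div 4), v)) K), v)
    else if (c - 5) mod 4 = 1 then
      prod_encode (push 0 (psnd ((c - 5) div 4)) (push 0 (pfst ((c - 5) div 4)) K), v)
    else if (c - 5) mod 4 = 2 then
      if psnd v = 0 then prod_encode (push 0 (pfst ((c - 5) div 4)) K, pfst v)
      else prod_encode (push 0 c (push 2 (psnd v - 1) (push 2 (pfst v) (push 0 (psnd ((c - 5) div 4)) K))),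
        prod_encode (pfst v, psnd v - 1))
    else prod_encode (push 0 ((c - 5) div 4) (push 3 (prod_encode ((c - 5) div 4, v)) K), v))"

text \<open>After a failed test of a search, \<open>8 + 4 * pfst c\<close> is the code of the
  \<open>MuP\<close> program itself, which is restarted at the next candidate.\<close>

definition frame_step :: "nat \<Rightarrow> nat \<Rightarrow> nat \<Rightarrow> nat \<Rightarrow> nat \<Rightarrow> nat" where
  "frame_step w t c v K = (
    if t = 0 then run_step w c v K
    else if t = 1 then prod_encode (push 0 (pfst c) (push 2 v K), psnd c)
    else if t = 2 then prod_encode (K, prod_encode (c, v))
    else if v = 0 then prod_encode (K, psnd (psnd c))
    else prod_encode (push 0 (8 + 4 * pfst c) K, prod_encode (pfst (psnd c), Suc (psnd (psnd c)))))"

definition step :: "nat \<Rightarrow> nat \<Rightarrow> nat" where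
  "step w s = (if pfst s = 0 then s else
    frame_step w (pfst (pfst (pfst s - 1))) (psnd (pfst (pfst s - 1))) (psnd s) (psnd (pfst s - 1)))"

definition eval_steps :: "nat \<Rightarrow> nat \<Rightarrow> nat \<Rightarrow> nat \<Rightarrow> nat" where
  "eval_steps w e x n = (step w ^^ n) (prod_encode (push 0 e 0, x))"

abbreviation halted :: "nat \<Rightarrow> nat \<Rightarrow> nat \<Rightarrow> nat \<Rightarrow> bool" where
  "halted w e x n \<equiv> pfst (eval_steps w e x n) = 0"

section \<open>Computability of the machine\<close>

lemma computable_lookup [computable_intros]:
  assumes "computable B Q f" "computable B Q g"
  shows "computable B Q (\<lambda>x. lookup (f x) (g x))"
  by (rule computable_apply2[OF _ assms], unfold lookup_def) (intro computable_intros)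

lemma computable_push [computable_intros]:
  assumes "computable B Q t" "computable B Q c" "computable B Q K"
  shows "computable B Q (\<lambda>x. push (t x) (c x) (K x))"
  unfolding push_def by (intro computable_intros assms)

lemma computable_run_step [computable_intros]:
  assumes "computable B Q w" "computable B Q c" "computable B Q v" "computable B Q K"
  shows "computable B Q (\<lambda>x. run_step (w x) (c x) (v x) (K x))"
  unfolding run_step_def by (intro computable_intros assms)

lemma computable_frame_step [computable_intros]:
  assumes "computable B Q w" "computable B Q t" "computable B Q c" "computable B Q v" "computable B Q K"
  shows "computable B Q (\<lambda>x. frame_step (w x) (t x) (c x) (v x) (K x))"
  unfolding frame_step_def by (intro computable_intros assms)

lemma computable_step [computable_intros]:
  assumes "computable B Q w" "computable B Q s"
  shows "computable B Q (\<lambda>x. step (w x) (s x))"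
  unfolding step_def by (intro computable_intros assms)

lemma computable_eval_steps [computable_intros]:
  assumes "computable B Q w" "computable B Q e" "computable B Q f" "computable B Q n"
  shows "computable B Q (\<lambda>x. eval_steps (w x) (e x) (f x) (n x))"
proof -
  have "computable B (\<lambda>_. {})
      (\<lambda>z. eval_steps (pfst (pfst z)) (psnd (pfst z)) (pfst (psnd z)) (psnd (psnd z)))"
    unfolding eval_steps_def by (intro computable_intros)
  from computable_apply[OF this computable_pair[OF computable_pair[OF assms(1,2)] computable_pair[OF assms(3,4)]]]
  show ?thesis by simp
qed

section \<open>The machine simulates every halting program\<close>

lemma push_inject [simp]: "push t c K = push t' c' K' \<longleftrightarrow> t = t' \<and> c = c' \<and> K = K'"
  by (auto simp: push_def prod_encode_eq)

lemma push_neq_0 [simp]: "push t c K \<noteq> 0" "0 \<noteq> push t c K"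
  by (simp_all add: push_def)

lemma push_exhaust: obtains "K = 0" | t c K' where "K = push t c K'"
  by (cases K) (auto simp: push_def, metis prod.collapse prod_decode_inverse)

lemma step_0: "step w (prod_encode (0, v)) = prod_encode (0, v)"
  by (simp add: step_def)

lemma step_push: "step w (prod_encode (push t c K, v)) = frame_step w t c v K"
  by (simp add: step_def push_def)

lemma mod4_add_mult: "(5 + 4 * k - 5) mod 4 = (0::nat)" "(6 + 4 * k - 5) mod 4 = (1::nat)"
  "(7 + 4 * k - 5) mod 4 = (2::nat)" "(8 + 4 * k - 5) mod 4 = (3::nat)"
  "(5 + 4 * k - 5) div 4 = (k::nat)" "(6 + 4 * k - 5) div 4 = (k::nat)"
  "(7 + 4 * k - 5) div 4 = (k::nat)" "(8 + 4 * k - 5) div 4 = (k::nat)"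
  using mod_mult_self2[of 2 4 k] by simp_all

lemma run_step_simps:
  "run_step w (prog_encode ZeroP) v K = prod_encode (K, 0)"
  "run_step w (prog_encode SuccP) v K = prod_encode (K, Suc v)"
  "run_step w (prog_encode FstP) v K = prod_encode (K, pfst v)"
  "run_step w (prog_encode SndP) v K = prod_encode (K, psnd v)"
  "run_step w (prog_encode OracleP) v K =
    (if lookup w v = 0 then prod_encode (push 0 (prog_encode OracleP) K, v) else prod_encode (K, lookup w v - 1))"
  "run_step w (prog_encode (PairP p q)) v K =
    prod_encode (push 0 (prog_encode p) (push 1 (prod_encode (prog_encode q, v)) K), v)"
  "run_step w (prog_encode (CompP p q)) v K =
    prod_encode (push 0 (prog_encode q) (push 0 (prog_encode p) K), v)"
  "run_step w (prog_encode (PrecP p q)) v K =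
    (if psnd v = 0 then prod_encode (push 0 (prog_encode p) K, pfst v)
      else prod_encode (push 0 (prog_encode (PrecP p q))
        (push 2 (psnd v - 1) (push 2 (pfst v) (push 0 (prog_encode q) K))),
        prod_encode (pfst v, psnd v - 1)))"
  "run_step w (prog_encode (MuP p)) v K =
    prod_encode (push 0 (prog_encode p) (push 3 (prod_encode (prog_encode p, v)) K), v)"
  unfolding run_step_def by (simp_all only: prog_encode.simps mod4_add_mult) simp_all

lemma frame_step_simps:
  "frame_step w 0 c v K = run_step w c v K"
  "frame_step w 1 (prod_encode (c, x)) v K = prod_encode (push 0 c (push 2 v K), x)"
  "frame_step w 2 c v K = prod_encode (K, prod_encode (c, v))"
  "frame_step w 3 (prod_encode (prog_encode p, x)) v K =
    (if v = 0 then prod_encode (K, psnd x)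
     else prod_encode (push 0 (prog_encode (MuP p)) K, prod_encode (pfst x, Suc (psnd x))))"
  by (simp_all add: frame_step_def)

definition reaches :: "nat \<Rightarrow> nat \<Rightarrow> nat \<Rightarrow> nat \<Rightarrow> nat \<Rightarrow> nat \<Rightarrow> bool" where
  "reaches w n K v K' v' \<longleftrightarrow> (step w ^^ n) (prod_encode (K, v)) = prod_encode (K', v')"

lemma reaches_trans: "reaches w m K v K' v' \<Longrightarrow> reaches w n K' v' K'' v'' \<Longrightarrow> reaches w (n + m) K v K'' v''"
  by (simp add: reaches_def funpow_add)

lemma reaches_step:
  assumes "frame_step w t c v K = prod_encode (K', v')" "reaches w n K' v' K'' v''"
  shows "reaches w (Suc n) (push t c K) v K'' v''"
  using assms by (simp add: reaches_def funpow_Suc_right step_push del: funpow.simps)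

lemma reaches_refl: "reaches w 0 K v K v"
  by (simp add: reaches_def)

text \<open>The step count depends only on the computation. Uniformity in \<open>K\<close> lets
  subprograms run on top of pending frames; uniformity in \<open>w\<close> allows tables that change
  from stage to stage.\<close>

lemma run_imp_reaches:
  assumes "run C p x y qs"
  shows "\<exists>n. \<forall>w K. (\<forall>q\<in>set qs. lookup w q = Suc (of_bool (q \<in> C))) \<longrightarrow>
    reaches w n (push 0 (prog_encode p) K) x K y"
  using assms
proof (induction rule: run.induct)
  case (Pair p x y qs q z rs)
  then obtain m n where m: "\<And>w K. (\<forall>q\<in>set qs. lookup w q = Suc (of_bool (q \<in> C))) \<Longrightarrow>
      reaches w m (push 0 (prog_encode p) K) x K y"
    and n: "\<And>w K. (\<forall>q\<in>set rs. lookup w q = Suc (of_bool (q \<in> C))) \<Longrightarrow>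
      reaches w n (push 0 (prog_encode q) K) x K z"
    by blast
  \<comment> \<open>One step splits the pair, \<open>m\<close> run \<open>p\<close>, one starts
    \<open>q\<close>, \<open>n\<close> run it, and one joins the two results.\<close>
  have "reaches w (Suc (Suc (Suc 0 + n) + m)) (push 0 (prog_encode (PairP p q)) K) x K (prod_encode (y, z))"
    if "\<forall>q\<in>set (qs @ rs). lookup w q = Suc (of_bool (q \<in> C))" for w K
    by (rule reaches_step, simp only: frame_step_simps run_step_simps,
      rule reaches_trans, rule m, use that in simp,
      rule reaches_step, simp only: frame_step_simps,
      rule reaches_trans, rule n, use that in simp,
      rule reaches_step, simp only: frame_step_simps, rule reaches_refl)
  then show ?case by blast
next
  case (Comp q x y qs p z rs)
  then obtain m n where m: "\<And>w K. (\<forall>q\<in>set qs. lookup w q = Suc (of_bool (q \<in> C))) \<Longrightarrow>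
      reaches w m (push 0 (prog_encode q) K) x K y"
    and n: "\<And>w K. (\<forall>q\<in>set rs. lookup w q = Suc (of_bool (q \<in> C))) \<Longrightarrow>
      reaches w n (push 0 (prog_encode p) K) y K z"
    by blast
  have "reaches w (Suc (n + m)) (push 0 (prog_encode (CompP p q)) K) x K z"
    if "\<forall>q\<in>set (qs @ rs). lookup w q = Suc (of_bool (q \<in> C))" for w K
    by (rule reaches_step, simp only: frame_step_simps run_step_simps,
      rule reaches_trans, rule m, use that in simp, rule n, use that in simp)
  then show ?case by blast
next
  case (Prec_0 p a y qs q)
  then obtain m where m: "\<And>w K. (\<forall>q\<in>set qs. lookup w q = Suc (of_bool (q \<in> C))) \<Longrightarrow>
      reaches w m (push 0 (prog_encode p) K) a K y"
    by blast
  have "reaches w (Suc m) (push 0 (prog_encode (PrecP p q)) K) (prod_encode (a, 0)) K y"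
    if "\<forall>q\<in>set qs. lookup w q = Suc (of_bool (q \<in> C))" for w K
    by (rule reaches_step[OF _ m[OF that]]) (simp add: frame_step_simps run_step_simps del: prog_encode.simps)
  then show ?case by blast
next
  case (Prec_Suc p q a i y qs z rs)
  then obtain m n where m: "\<And>w K. (\<forall>q\<in>set qs. lookup w q = Suc (of_bool (q \<in> C))) \<Longrightarrow>
      reaches w m (push 0 (prog_encode (PrecP p q)) K) (prod_encode (a, i)) K y"
    and n: "\<And>w K. (\<forall>q\<in>set rs. lookup w q = Suc (of_bool (q \<in> C))) \<Longrightarrow>
      reaches w n (push 0 (prog_encode q) K) (prod_encode (a, prod_encode (i, y))) K z"
    by blast
  \<comment> \<open>One step unfolds the recursion, \<open>m\<close> compute the previous value, two
    assemble the argument of \<open>q\<close>, and \<open>n\<close> run \<open>q\<close>.\<close>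
  have "reaches w (Suc (Suc (Suc n) + m)) (push 0 (prog_encode (PrecP p q)) K) (prod_encode (a, Suc i)) K z"
    if w: "\<forall>q\<in>set (qs @ rs). lookup w q = Suc (of_bool (q \<in> C))" for w K
  proof (rule reaches_step)
    show "frame_step w 0 (prog_encode (PrecP p q)) (prod_encode (a, Suc i)) K = prod_encode
        (push 0 (prog_encode (PrecP p q)) (push 2 i (push 2 a (push 0 (prog_encode q) K))), prod_encode (a, i))"
      by (simp add: frame_step_simps run_step_simps del: prog_encode.simps)
    show "reaches w (Suc (Suc n) + m)
        (push 0 (prog_encode (PrecP p q)) (push 2 i (push 2 a (push 0 (prog_encode q) K)))) (prod_encode (a, i)) K z"
      by (rule reaches_trans, rule m, use w in simp,
        rule reaches_step, simp only: frame_step_simps, rule reaches_step, simp only: frame_step_simps,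
        rule n, use w in simp)
  qed
  then show ?case by blast
next
  case (Mu_stop p a i qs)
  then obtain m where m: "\<And>w K. (\<forall>q\<in>set qs. lookup w q = Suc (of_bool (q \<in> C))) \<Longrightarrow>
      reaches w m (push 0 (prog_encode p) K) (prod_encode (a, i)) K 0"
    by blast
  have "reaches w (Suc (Suc 0 + m)) (push 0 (prog_encode (MuP p)) K) (prod_encode (a, i)) K i"
    if w: "\<forall>q\<in>set qs. lookup w q = Suc (of_bool (q \<in> C))" for w K
  proof (rule reaches_step, simp only: frame_step_simps run_step_simps, rule reaches_trans, rule m, use w in simp)
    show "reaches w (Suc 0) (push 3 (prod_encode (prog_encode p, prod_encode (a, i))) K) 0 K i"
      by (rule reaches_step[OF _ reaches_refl]) (simp add: frame_step_simps)
  qed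
  then show ?case by blast
next
  case (Mu_step p a i v qs y rs)
  then obtain m n where m: "\<And>w K. (\<forall>q\<in>set qs. lookup w q = Suc (of_bool (q \<in> C))) \<Longrightarrow>
      reaches w m (push 0 (prog_encode p) K) (prod_encode (a, i)) K (Suc v)"
    and n: "\<And>w K. (\<forall>q\<in>set rs. lookup w q = Suc (of_bool (q \<in> C))) \<Longrightarrow>
      reaches w n (push 0 (prog_encode (MuP p)) K) (prod_encode (a, Suc i)) K y"
    by blast
  have "reaches w (Suc (Suc n + m)) (push 0 (prog_encode (MuP p)) K) (prod_encode (a, i)) K y"
    if w: "\<forall>q\<in>set (qs @ rs). lookup w q = Suc (of_bool (q \<in> C))" for w K
  proof (rule reaches_step, simp only: frame_step_simps run_step_simps, rule reaches_trans, rule m, use w in simp)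
    show "reaches w (Suc n) (push 3 (prod_encode (prog_encode p, prod_encode (a, i))) K) (Suc v) K y"
      by (rule reaches_step[OF _ n]) (use w in \<open>simp_all add: frame_step_simps del: prog_encode.simps\<close>)
  qed
  then show ?case by blast
next
  case (Oracle x)
  have "reaches w (Suc 0) (push 0 (prog_encode OracleP) K) x K (of_bool (x \<in> C))"
    if "\<forall>q\<in>set [x]. lookup w q = Suc (of_bool (q \<in> C))" for w K
    by (rule reaches_step[OF _ reaches_refl])
      (use that in \<open>simp add: frame_step_simps run_step_simps del: prog_encode.simps\<close>)
  then show ?case by blast
qed (rule exI[of _ "Suc 0"], intro allI impI, rule reaches_step[OF _ reaches_refl],
  simp add: frame_step_simps run_step_simps del: prog_encode.simps)+

lemma halted_stable:
  assumes "eval_steps w e x m = prod_encode (0, y)" "m \<le> n"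
  shows "eval_steps w e x n = prod_encode (0, y)"
proof -
  have "(step w ^^ k) (prod_encode (0, y)) = prod_encode (0, y)" for k
    by (induction k) (simp_all add: step_0)
  then show ?thesis
    using assms(1) funpow_add[of "n - m" m "step w"] assms(2) by (simp add: eval_steps_def)
qed

lemma run_imp_eval:
  assumes "run C p x y qs"
  obtains n where "\<And>w m. (\<And>q. q \<in> set qs \<Longrightarrow> lookup w q = Suc (of_bool (q \<in> C))) \<Longrightarrow> n \<le> m \<Longrightarrow>
    eval_steps w (prog_encode p) x m = prod_encode (0, y)"
  using run_imp_reaches[OF assms] halted_stable unfolding reaches_def eval_steps_def by metis

section \<open>Soundness of halting machine computations\<close>

definition frame_rel :: "nat set \<Rightarrow> nat \<Rightarrow> nat \<Rightarrow> nat \<Rightarrow> nat \<Rightarrow> bool" where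
  "frame_rel C t c v u \<longleftrightarrow> (
    if t = 0 then \<exists>p qs. c = prog_encode p \<and> run C p v u qs
    else if t = 1 then \<exists>p z qs. pfst c = prog_encode p \<and> run C p (psnd c) z qs \<and> u = prod_encode (v, z)
    else if t = 2 then u = prod_encode (c, v)
    else if v = 0 then u = psnd (psnd c)
    else \<exists>p qs. pfst c = prog_encode p \<and> run C (MuP p) (prod_encode (pfst (psnd c), Suc (psnd (psnd c)))) u qs)"

text \<open>\<open>frame_rel\<close> gives the meaning of a frame: fed with \<open>v\<close>, it
  hands \<open>u\<close> to the frames below. Chaining these meanings describes the final value
  through \<open>run\<close> instead of machine steps, an invariant that can be pulled back along
  steps.\<close>

inductive stack_rel :: "nat set \<Rightarrow> nat \<Rightarrow> nat \<Rightarrow> nat \<Rightarrow> bool" for C where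
  "stack_rel C 0 v v"
| "frame_rel C t c v u \<Longrightarrow> stack_rel C K u y \<Longrightarrow> stack_rel C (push t c K) v y"

lemma stack_rel_0 [simp]: "stack_rel C 0 v y \<longleftrightarrow> y = v"
  by (auto elim: stack_rel.cases intro: stack_rel.intros)

lemma stack_rel_push [simp]: "stack_rel C (push t c K) v y \<longleftrightarrow> (\<exists>u. frame_rel C t c v u \<and> stack_rel C K u y)"
  using stack_rel.simps[of C "push t c K" v y] by auto

lemma inj_prog_encode [simp]: "prog_encode p = prog_encode q \<longleftrightarrow> p = q"
  using bij_prog_encode by (simp add: bij_def inj_eq)

lemma frame_rel_simps:
  "frame_rel C 0 (prog_encode p) v u \<longleftrightarrow> (\<exists>qs. run C p v u qs)"
  "frame_rel C 1 (prod_encode (prog_encode p, x)) v u \<longleftrightarrow> (\<exists>z qs. run C p x z qs \<and> u = prod_encode (v, z))"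
  "frame_rel C 2 c v u \<longleftrightarrow> u = prod_encode (c, v)"
  "frame_rel C 3 (prod_encode (prog_encode p, x)) v u \<longleftrightarrow> (if v = 0 then u = psnd x else 
    \<exists>qs. run C (MuP p) (prod_encode (pfst x, Suc (psnd x))) u qs)"
  by (auto simp: frame_rel_def)

text \<open>The invariant passes from the successor state back to the current one by the matching
  rule of \<open>run\<close>. On an unknown query both states coincide.\<close>

lemma run_step_sound:
  assumes "lookup w v = 0 \<or> lookup w v = Suc (of_bool (v \<in> C))"
    and "run_step w (prog_encode p) v K = prod_encode (K', v')" and "stack_rel C K' v' y"
  shows "stack_rel C (push 0 (prog_encode p) K) v y"
proof -
  obtain a b where v: "v = prod_encode (a, b)" by (metis prod.collapse prod_decode_inverse)
  show ?thesis
  proof (cases p)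
    case (PairP p1 p2)
    with assms(2,3) show ?thesis
      by (auto simp: run_step_simps frame_rel_simps frame_rel_simps(2)[unfolded One_nat_def] prod_encode_eq
        simp del: prog_encode.simps dest!: sym[of _ K']) (blast intro: run.intros)
  next
    case (CompP p1 p2)
    with assms(2,3) show ?thesis
      by (auto simp: run_step_simps frame_rel_simps prod_encode_eq
        simp del: prog_encode.simps dest!: sym[of _ K']) (blast intro: run.intros)
  next
    case (PrecP p1 p2)
    show ?thesis
    proof (cases b)
      case 0
      with assms(2,3) show ?thesis unfolding PrecP v
        by (auto simp: run_step_simps frame_rel_simps prod_encode_eq simp del: prog_encode.simps
          dest!: sym[of _ K']) (blast intro: run.intros)
    next
      case (Suc n)
      with assms(2,3) show ?thesis unfolding PrecP v
        by (auto simp: run_step_simps frame_rel_simps prod_encode_eq simp del: prog_encode.simps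
          dest!: sym[of _ K']) (blast intro: run.intros)
    qed
  next
    case (MuP p1)
    with assms(2) have K': "K' = push 0 (prog_encode p1) (push 3 (prod_encode (prog_encode p1, v)) K)" "v' = v"
      by (auto simp: run_step_simps prod_encode_eq simp del: prog_encode.simps)
    from assms(3)[unfolded K'] obtain z qs u where z: "run C p1 v z qs"
      "frame_rel C 3 (prod_encode (prog_encode p1, v)) z u" "stack_rel C K u y"
      by (auto simp: frame_rel_simps)
    then have "\<exists>qs. run C (MuP p1) v u qs"
      unfolding v by (cases z) (auto simp: frame_rel_simps intro: run.intros)
    with z(3) show ?thesis by (auto simp: MuP frame_rel_simps simp del: prog_encode.simps)
  qed (use assms v in \<open>auto simp: run_step_simps frame_rel_simps prod_encode_eq simp del: prog_encode.simps
          dest!: sym[of _ K'] intro: run.intros split: if_splits\<close>)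
qed

lemma step_sound:
  assumes "\<And>q. lookup w q = 0 \<or> lookup w q = Suc (of_bool (q \<in> C))"
    and "step w (prod_encode (K, v)) = prod_encode (K', v')" and "stack_rel C K' v' y"
  shows "stack_rel C K v y"
proof (cases K rule: push_exhaust)
  case 1
  with assms(2,3) show ?thesis by (simp add: step_0 prod_encode_eq)
next
  case (2 t c K1)
  \<comment> \<open>Every number codes a program, and tags above 2 all behave like 3, so no stack is
    ill-formed.\<close>
  obtain p where p: "c = prog_encode p" using bij_prog_encode by (metis bij_pointE)
  obtain q where q: "pfst c = prog_encode q" using bij_prog_encode by (metis bij_pointE)
  from assms(2) have "frame_step w t c v K1 = prod_encode (K', v')" by (simp add: \<open>K = _\<close> step_push)
  consider "t = 0" | "t = 1" | "t = 2" | "t > 2" by linarith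
  then show ?thesis
  proof cases
    case 1
    then show ?thesis using run_step_sound[of w v C p K1 K' v' y] assms(1,3)
      \<open>frame_step w t c v K1 = _\<close> by (simp add: \<open>K = _\<close> p frame_step_def)
  next
    case 4
    have "8 + 4 * prog_encode q = prog_encode (MuP q)" by simp
    with 4 show ?thesis using \<open>frame_step w t c v K1 = _\<close> assms(3) q
      by (auto simp: \<open>K = _\<close> frame_step_def frame_rel_def prod_encode_eq simp del: prog_encode.simps
        dest!: sym[of _ K'] sym[of _ v'] split: if_splits)
  next
    case 2
    then show ?thesis using \<open>frame_step w t c v K1 = _\<close> assms(3) q
      by (auto simp: \<open>K = _\<close> frame_step_def frame_rel_def prod_encode_eq
        dest!: sym[of _ K'] sym[of _ v']) blast
  next
    case 3
    then show ?thesis using \<open>frame_step w t c v K1 = _\<close> assms(3)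
      by (auto simp: \<open>K = _\<close> frame_step_def frame_rel_def prod_encode_eq
        dest!: sym[of _ K'] sym[of _ v'])
  qed
qed

text \<open>In the halted state the empty stack returns its value; \<open>step_sound\<close> carries
  \<open>stack_rel\<close> from there back to the initial state, where it is a statement about
  \<open>run\<close>. Unknown entries do no harm, as the machine never passes them.\<close>

lemma eval_sound:
  assumes "\<And>q. lookup w q = 0 \<or> lookup w q = Suc (of_bool (q \<in> C))"
    and "eval_steps w (prog_encode p) x n = prod_encode (0, y)"
  shows "\<exists>qs. run C p x y qs"
proof -
  have "stack_rel C K v y" if "(step w ^^ n) (prod_encode (K, v)) = prod_encode (0, y)" for n K v
    using that
  proof (induction n arbitrary: K v)
    case (Suc n)
    obtain K' v' where "step w (prod_encode (K, v)) = prod_encode (K', v')"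
      by (metis prod.collapse prod_decode_inverse)
    with Suc show ?case
      by (auto simp: funpow_Suc_right simp del: funpow.simps intro: step_sound[OF assms(1)])
  qed (simp add: prod_encode_eq)
  from this[OF assms(2)[unfolded eval_steps_def]] show ?thesis
    by (auto simp: frame_rel_simps)
qed

section \<open>Finite oracle tables\<close>

definition table :: "(nat \<Rightarrow> nat) \<Rightarrow> nat \<Rightarrow> nat" where
  "table d s = rec_nat 0 (\<lambda>i r. prod_encode (d (s - Suc i), r)) s"

lemma lookup_table: "lookup (table d s) x = (if x < s then d x else 0)"
proof -
  \<comment> \<open>Stage \<open>i\<close> prepends entry \<open>s - Suc i\<close>, so entry 0 ends
    up outermost. As 0 decodes to \<open>(0, 0)\<close>, positions from \<open>s\<close> on read as
    0, that is, as unknown.\<close>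
  define T where "T = rec_nat 0 (\<lambda>i r. prod_encode (d (s - Suc i), r))"
  have T0: "T 0 = 0" and TS: "T (Suc n) = prod_encode (d (s - Suc n), T n)" for n
    by (simp_all add: T_def)
  have dec0: "prod_decode 0 = (0, 0)" by (simp add: prod_decode_def prod_decode_aux.simps)
  have psnd: "psnd (T m) = T (m - 1)" and pfst: "pfst (T m) = (if m = 0 then 0 else d (s - m))" for m
    by (cases m; simp add: T0 TS dec0)+
  have "(psnd ^^ x) (T n) = T (n - x)" for n
    by (induction x) (simp_all add: psnd)
  then have "lookup (table d s) x = pfst (T (s - x))" by (simp add: lookup_def table_def T_def)
  then show ?thesis by (auto simp: pfst)
qed

lemma computable_table [computable_intros]:
  assumes "computable B (\<lambda>_. S) (\<lambda>z. d (pfst z) (psnd z))" "computable B (\<lambda>_. S) s"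
  shows "computable B (\<lambda>_. S) (\<lambda>x. table (d x) (s x))"
proof -
  have "computable B (\<lambda>_. S) (\<lambda>z. d (pfst z) (s (pfst z) - Suc (pfst (psnd z))))"
    using computable_compose[OF assms(1), of "\<lambda>_. S" "\<lambda>z. prod_encode (pfst z, s (pfst z) - Suc (pfst (psnd z)))"]
      computable_compose[OF assms(2), of "\<lambda>_. S" pfst]
    by (simp add: computable_intros)
  then show ?thesis
    unfolding table_def by (intro computable_intros assms)
qed


section \<open>Totality and highness\<close>

lemma turing_le_trans:
  assumes "A \<le>\<^sub>T B" and "B \<le>\<^sub>T C" shows "A \<le>\<^sub>T C"
proof -
  obtain p r where p: "reduction p B A" and r: "reduction r C B"
    using assms by (auto simp: turing_le_def)
  then have "reduction (replace_oracle r p) C A"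
    unfolding reduction_def using run_replace_oracle[OF _ r] by meson
  then show ?thesis by (auto simp: turing_le_def)
qed

lemma decidable_imp [computable_intros]:
  "decidable B Q P \<Longrightarrow> decidable B Q P' \<Longrightarrow> decidable B Q (\<lambda>x. P x \<longrightarrow> P' x)"
  unfolding imp_conv_disj by (intro computable_intros)

lemma decidable_member [computable_intros]:
  "computable B (\<lambda>_. UNIV) f \<Longrightarrow> decidable B (\<lambda>_. UNIV) (\<lambda>x. f x \<in> B)"
  by (rule computable_compose[OF decidable_oracle]) auto

section \<open>Totality is decidable in the second jump\<close>

definition total_prog :: "prog \<Rightarrow> bool" where
  "total_prog p \<longleftrightarrow> (\<forall>n. \<exists>y qs. run {} p n y qs)"

lemma run_MuP_imp_zero:
  "run B p x y qs \<Longrightarrow> p = MuP q \<Longrightarrow> \<exists>rs. run B q (prod_encode (pfst x, y)) 0 rs"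
  by (induction rule: run.induct) auto

text \<open>As \<open>M\<close> halts everywhere, the search diverges only if there is no zero. This
  turns an existential statement with decidable matrix into a halting statement.\<close>

lemma run_MuP_iff:
  assumes M: "\<And>z. \<exists>qs. run B M z (f z) qs"
  shows "(\<exists>y qs. run B (MuP M) (prod_encode (a, 0)) y qs) \<longleftrightarrow> (\<exists>n. f (prod_encode (a, n)) = 0)"
proof
  assume "\<exists>y qs. run B (MuP M) (prod_encode (a, 0)) y qs"
  then obtain y rs where "run B M (prod_encode (a, y)) 0 rs"
    using run_MuP_imp_zero by fastforce
  then show "\<exists>n. f (prod_encode (a, n)) = 0"
    using M run_deterministic by metis
next
  assume "\<exists>n. f (prod_encode (a, n)) = 0"
  then obtain n where n: "f (prod_encode (a, n)) = 0" by blast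
  have "\<exists>y qs. run B (MuP M) (prod_encode (a, m)) y qs" if "m \<le> n" for m
    using that
  proof (induction m rule: inc_induct)
    case base
    then show ?case using M[of "prod_encode (a, n)"] n run.Mu_stop by fastforce
  next
    case (step m)
    then show ?case using M[of "prod_encode (a, m)"] run.Mu_stop run.Mu_step
      by (cases "f (prod_encode (a, m))") fastforce+
  qed
  then show "\<exists>y qs. run B (MuP M) (prod_encode (a, 0)) y qs" by simp
qed

lemma run_CompP_iff:
  assumes "run B q x z rs"
  shows "(\<exists>y qs. run B (CompP p q) x y qs) \<longleftrightarrow> (\<exists>y qs. run B p z y qs)"
proof
  assume "\<exists>y qs. run B (CompP p q) x y qs"
  then obtain y qs where "run B (CompP p q) x y qs" by blast
  then show "\<exists>y qs. run B p z y qs"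
    by (cases rule: run.cases) (use assms run_deterministic in blast)
qed (use assms run.Comp in blast)

lemma jump_iff: "prog_encode p \<in> jump B \<longleftrightarrow> (\<exists>y qs. run B p (prog_encode p) y qs)"
  by (auto simp: jump_def)

text \<open>Here 1 is the code of \<open>SuccP\<close> and 6 the offset of \<open>CompP\<close>. The
  recursion shows that codes of constant programs are computable, which takes the role of the s-m-n
  theorem.\<close>

lemma prog_encode_const_prog:
  "prog_encode (const_prog n) = rec_nat 0 (\<lambda>_ r. 6 + 4 * prod_encode (1, r)) n"
  by (induction n) auto

text \<open>Totality is a Pi_2 property: \<open>jump {}\<close> decides halting on a given input,
  and the search for an input without halting is a halting problem relative to
  \<open>jump {}\<close>.\<close>

lemma total_le_jump_jump: "{prog_encode p | p. total_prog p} \<le>\<^sub>T jump (jump {})"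
proof -
  \<comment> \<open>The value at \<open>(e, n)\<close> codes the composition of program
    \<open>e\<close> with the constant \<open>n\<close>; it ignores its input, so halting on its own
    code means that \<open>e\<close> halts on \<open>n\<close>.\<close>
  define c where "c = (\<lambda>z. 6 + 4 * prod_encode (pfst z, prog_encode (const_prog (psnd z))))"
  have c: "c (prod_encode (prog_encode p, n)) \<in> jump {} \<longleftrightarrow> (\<exists>y qs. run {} p n y qs)" for p n
    using jump_iff[of "CompP p (const_prog n)"] run_CompP_iff[OF run_const_prog] by (simp add: c_def)
  have "decidable (jump {}) (\<lambda>_. UNIV) (\<lambda>z. c z \<in> jump {})"
    unfolding c_def prog_encode_const_prog by (intro computable_intros)
  then obtain M where M: "\<And>z. \<exists>qs. run (jump {}) M z (of_bool (c z \<in> jump {})) qs"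
    unfolding computable_def by blast
  \<comment> \<open>\<open>u e\<close> codes the program that ignores its input and starts at
    \<open>(e, 0)\<close> the search for an \<open>n\<close> on which \<open>e\<close>
    diverges.\<close>
  define u where "u = (\<lambda>e. 6 + 4 * prod_encode (prog_encode (MuP M),
    5 + 4 * prod_encode (prog_encode (const_prog e), 0)))"
  have "u e = prog_encode (CompP (MuP M) (PairP (const_prog e) ZeroP))" for e
    by (simp add: u_def)
  then have "u e \<in> jump (jump {}) \<longleftrightarrow> (\<exists>n. c (prod_encode (e, n)) \<notin> jump {})" for e
    using jump_iff run_CompP_iff[OF run.Pair[OF run_const_prog run.Zero]] run_MuP_iff[OF M]
    by (simp del: prog_encode.simps)
  then have u: "u (prog_encode p) \<in> jump (jump {}) \<longleftrightarrow> \<not> total_prog p" for p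
    by (simp add: c total_prog_def)
  have "e \<in> {prog_encode p | p. total_prog p} \<longleftrightarrow> u e \<notin> jump (jump {})" for e
  proof -
    obtain p where "e = prog_encode p" using bij_prog_encode by (metis bij_pointE)
    then show ?thesis using u by auto
  qed
  moreover have "decidable (jump (jump {})) (\<lambda>_. UNIV) (\<lambda>e. u e \<notin> jump (jump {}))"
    unfolding u_def prog_encode_const_prog by (intro computable_intros)
  ultimately show ?thesis by (simp add: turing_le_iff_decidable)
qed

section \<open>Finite approximations and the limit lemma\<close>

definition oracle_table :: "nat set \<Rightarrow> nat \<Rightarrow> nat" where
  "oracle_table C = table (\<lambda>x. Suc (of_bool (x \<in> C)))"

lemma lookup_oracle_table:
  "lookup (oracle_table C s) x = (if x < s then Suc (of_bool (x \<in> C)) else 0)"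
  by (simp add: oracle_table_def lookup_table)

lemma eval_oracle_table_sound:
  "eval_steps (oracle_table C s) (prog_encode p) x n = prod_encode (0, y) \<Longrightarrow> \<exists>qs. run C p x y qs"
  by (erule eval_sound[rotated]) (simp add: lookup_oracle_table)

lemma halted_oracle_table_sound:
  "halted (oracle_table C s) (prog_encode p) x n \<Longrightarrow> \<exists>y qs. run C p x y qs"
  using eval_oracle_table_sound by (metis prod.collapse prod_decode_inverse)

text \<open>A halting computation asks finitely many questions. From some stage on,
  \<open>J s\<close> answers them correctly, the table is long enough to contain them, and the
  number of steps suffices.\<close>

lemma eventually_eval_eq:
  assumes "run C p x y qs" and "\<And>q. q \<in> set qs \<Longrightarrow> \<forall>\<^sub>F s in sequentially. q \<in> J s \<longleftrightarrow> q \<in> C"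
  shows "\<forall>\<^sub>F s in sequentially. eval_steps (oracle_table (J s) s) (prog_encode p) x s = prod_encode (0, y)"
proof -
  obtain n where n: "\<And>w m. (\<And>q. q \<in> set qs \<Longrightarrow> lookup w q = Suc (of_bool (q \<in> C))) \<Longrightarrow> n \<le> m \<Longrightarrow>
      eval_steps w (prog_encode p) x m = prod_encode (0, y)"
    using run_imp_eval[OF assms(1)] by blast
  have "\<forall>\<^sub>F s in sequentially. \<forall>q\<in>set qs. (q \<in> J s \<longleftrightarrow> q \<in> C) \<and> q < s"
    using assms(2) eventually_gt_at_top by (auto intro!: eventually_ball_finite eventually_conj)
  with eventually_ge_at_top[of n] show ?thesis
    by eventually_elim (rule n, auto simp: lookup_oracle_table)
qed

corollary eventually_eval:
  assumes "run C p x y qs"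
  shows "\<forall>\<^sub>F s in sequentially. eval_steps (oracle_table C s) (prog_encode p) x s = prod_encode (0, y)"
  using eventually_eval_eq[OF assms, of "\<lambda>_. C"] by simp

definition jump_stage :: "nat set \<Rightarrow> nat \<Rightarrow> nat set" where
  "jump_stage D s = {i. halted (oracle_table D s) i i s}"

text \<open>Members are eventually confirmed, and soundness excludes false members at every
  stage.\<close>

lemma eventually_jump_stage: "\<forall>\<^sub>F s in sequentially. i \<in> jump_stage D s \<longleftrightarrow> i \<in> jump D"
proof -
  obtain p where i: "i = prog_encode p" using bij_prog_encode by (metis bij_pointE)
  show ?thesis
  proof (cases "i \<in> jump D")
    case True
    then obtain y qs where "run D p i y qs" using jump_iff i by blast
    from eventually_eval[OF this] show ?thesis
      by eventually_elim (use True in \<open>simp add: jump_stage_def i\<close>)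
  next
    case False
    then show ?thesis
      using halted_oracle_table_sound jump_iff unfolding jump_stage_def i
      by (intro always_eventually) blast
  qed
qed

abbreviation halts_by :: "nat \<Rightarrow> nat \<Rightarrow> nat \<Rightarrow> bool" where
  "halts_by e x s \<equiv> halted (oracle_table {} s) e x s"

text \<open>Tables of the empty oracle are built without queries, so the bound \<open>Q\<close> may
  vary with the input; the search for halting times in \<open>tiny_use\<close> relies on
  this.\<close>

lemma computable_oracle_table_empty [computable_intros]:
  assumes "computable B Q s" shows "computable B Q (\<lambda>x. oracle_table {} (s x))"
proof (rule computable_apply[OF _ assms])
  show "computable B (\<lambda>_. {}) (oracle_table {})"
    unfolding oracle_table_def empty_iff by (intro computable_intros)
qed

lemma computable_oracle_table [computable_intros]:
  assumes "decidable B (\<lambda>_. S) (\<lambda>z. psnd z \<in> C (pfst z))" "computable B (\<lambda>_. S) s"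
  shows "computable B (\<lambda>_. S) (\<lambda>x. oracle_table (C x) (s x))"
  unfolding oracle_table_def by (intro computable_intros assms)

text \<open>
  Martin's argument: by highness and the limit lemma, ``\<open>e\<close> is not total'' has a \<open>D\<close>-computable
  approximation. For each \<open>(e, j)\<close>, look beyond stage \<open>j\<close> for a stage at which either \<open>e\<close> has halted
  on \<open>j\<close> or the approximation denies totality; one of the two happens, and \<open>W\<close> records the former.
\<close>

lemma high_enumerates_total:
  assumes "jump (jump {}) \<le>\<^sub>T jump D"
  obtains W where "W \<le>\<^sub>T D"
    and "\<And>e j. prod_encode (e, j) \<in> W \<Longrightarrow> \<exists>s. halts_by e j s"
    and "\<And>p. total_prog p \<Longrightarrow> \<forall>\<^sub>F j in sequentially. prod_encode (prog_encode p, j) \<in> W"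
proof -
  obtain t where t: "\<And>e. \<exists>qs. run (jump D) t e (of_bool (e \<in> {prog_encode p | p. total_prog p})) qs"
    using turing_le_trans[OF total_le_jump_jump assms] by (auto simp: turing_le_def reduction_def)
  \<comment> \<open>\<open>NT s e\<close> is the guess at stage \<open>s\<close> that
    \<open>e\<close> is not total: \<open>t\<close> is simulated on the approximation to
    \<open>jump D\<close>, and output 0 denies totality. An unfinished simulation counts as no
    denial.\<close>
  define NT where "NT = (\<lambda>s e.
    eval_steps (oracle_table (jump_stage D s) s) (prog_encode t) e s = prod_encode (0, 0))"
  have ev: "\<forall>\<^sub>F s in sequentially. NT s (prog_encode p) \<longleftrightarrow> \<not> total_prog p" for p
  proof -
    obtain qs where "run (jump D) t (prog_encode p) (of_bool (total_prog p)) qs"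
      using t[of "prog_encode p"] by auto
    from eventually_eval_eq[OF this eventually_jump_stage]
    show ?thesis by eventually_elim (simp add: NT_def prod_encode_eq)
  qed
  have halts: "\<forall>\<^sub>F s in sequentially. halts_by (prog_encode p) j s" if p: "total_prog p" for p j
  proof -
    obtain y qs where "run {} p j y qs" using p unfolding total_prog_def by blast
    from eventually_eval[OF this] show ?thesis by eventually_elim simp
  qed
  define stop where "stop = (\<lambda>z. LEAST m. halts_by (pfst z) (psnd z) (m + psnd z) \<or> NT (m + psnd z) (pfst z))"
  define W where "W = {z. halts_by (pfst z) (psnd z) (stop z + psnd z)}"
  have ex: "\<exists>m. halts_by (pfst z) (psnd z) (m + psnd z) \<or> NT (m + psnd z) (pfst z)" for z
  proof -
    obtain p where p: "pfst z = prog_encode p" using bij_prog_encode by (metis bij_pointE)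
    have "\<forall>\<^sub>F s in sequentially. halts_by (pfst z) (psnd z) s \<or> NT s (pfst z)"
      using ev[of p] halts[of p "psnd z"] unfolding p by (cases "total_prog p") (auto elim: eventually_mono)
    then obtain N where "\<And>s. s \<ge> N \<Longrightarrow> halts_by (pfst z) (psnd z) s \<or> NT s (pfst z)"
      by (auto simp: eventually_sequentially)
    then show ?thesis using le_add1 by blast
  qed
  show thesis
  proof
    have stop: "computable D (\<lambda>_. UNIV) stop"
      unfolding stop_def NT_def jump_stage_def mem_Collect_eq
      using ex[unfolded NT_def jump_stage_def]
      by (intro computable_intros; (unfold mem_Collect_eq)?) (intro computable_intros | assumption)+
    show "W \<le>\<^sub>T D"
      unfolding turing_le_iff_decidable W_def mem_Collect_eq by (intro computable_intros stop)
  next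
    fix e j assume "prod_encode (e, j) \<in> W"
    then show "\<exists>s. halts_by e j s" by (auto simp: W_def)
  next
    fix p assume "total_prog p"
    obtain N where N: "\<And>s. s \<ge> N \<Longrightarrow> \<not> NT s (prog_encode p)"
      using ev[of p] \<open>total_prog p\<close> by (auto simp: eventually_sequentially)
    \<comment> \<open>The stage found is at least \<open>j\<close>, hence at least \<open>N\<close>,
      where \<open>NT\<close> fails; the search can only have ended because the program
      halted.\<close>
    have "prod_encode (prog_encode p, j) \<in> W" if "j \<ge> N" for j
      using LeastI_ex[OF ex[of "prod_encode (prog_encode p, j)"]] N that
      by (simp add: W_def stop_def)
    then show "\<forall>\<^sub>F j in sequentially. prod_encode (prog_encode p, j) \<in> W"
      by (auto simp: eventually_sequentially)
  qed
qed

section \<open>Sparse sets and reductions with tiny use\<close>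

lemma computable_from_range:
  fixes a :: "nat \<Rightarrow> nat"
  assumes "strict_mono a"
  shows "computable (range a) (\<lambda>_. UNIV) a"
proof -
  let ?A = "range a"
  have less: "a i < a j \<longleftrightarrow> i < j" for i j using assms by (simp add: strict_mono_less)
  have ex: "\<exists>d. Suc y + d \<in> ?A" for y
    using strict_mono_imp_increasing[OF assms, of "Suc y"] le_Suc_ex by (metis rangeI)
  \<comment> \<open>Searching for the distance \<open>d\<close> from \<open>Suc y\<close> skips
    everything up to \<open>y\<close>, so the search yields the next element of the range.\<close>
  have "rec_nat (LEAST y. y \<in> ?A) (\<lambda>_ y. Suc y + (LEAST d. Suc y + d \<in> ?A)) k = a k" for k
  proof (induction k)
    case 0
    have "(LEAST y. y \<in> ?A) = a 0"
      by (rule Least_equality) (auto simp: strict_mono_less_eq[OF assms])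
    then show ?case by simp
  next
    case (Suc k)
    have "Suc (a k) \<le> a (Suc k)" using less[of k "Suc k"] by simp
    moreover have "a (Suc k) \<le> Suc (a k) + d" if d: "Suc (a k) + d \<in> ?A" for d
    proof -
      obtain j where j: "Suc (a k) + d = a j" using d by auto
      then have "k < j" using less[of k j] by simp
      then show ?thesis using j strict_mono_less_eq[OF assms, of "Suc k" j] by simp
    qed
    ultimately have "(LEAST d. Suc (a k) + d \<in> ?A) = a (Suc k) - Suc (a k)"
      by (intro Least_equality) (auto simp: le_diff_conv add.commute)
    with \<open>Suc (a k) \<le> a (Suc k)\<close> have "a (Suc k) = Suc (a k) + (LEAST d. Suc (a k) + d \<in> ?A)"
      by simp
    then show ?case by (simp only: old.nat.rec Suc)
  qed
  moreover have "computable ?A (\<lambda>_. UNIV) (\<lambda>k. rec_nat (LEAST y. y \<in> ?A) (\<lambda>_ y. Suc y + (LEAST d. Suc y + d \<in> ?A)) k)"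
    by (intro computable_intros ex)
  ultimately show ?thesis by (simp only:)
qed

text \<open>Bounds the codes of all entries on or below the diagonal in rows up to \<open>k\<close>
  at once, hence the part of the oracle that these rows occupy.\<close>

lemma prod_encode_le_diag:
  assumes "e \<le> j" "j \<le> k" shows "prod_encode (j, e) \<le> prod_encode (k, k)"
proof -
  have "mono triangle" by (rule mono_iff_le_Suc[THEN iffD2]) simp
  then have "triangle (j + e) \<le> triangle (k + k)" using assms by (auto elim: monoD)
  then show ?thesis using assms by (simp add: prod_encode_def)
qed

lemma tiny_use:
  assumes halts: "\<And>e j. e < j \<Longrightarrow> prod_encode (j, e) \<in> B \<Longrightarrow> \<exists>s. halts_by e j s"
    and total: "\<And>p. total_prog p \<Longrightarrow> \<forall>\<^sub>F j in sequentially. prod_encode (j, prog_encode p) \<in> B"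
  shows "\<exists>A. A \<le>\<^sub>u\<^sub>T\<^sub>t\<^sub>u B \<and> {k. prod_encode (k, k) \<in> B} \<le>\<^sub>T A"
proof -
  \<comment> \<open>The restriction to \<open>e < j\<close> leaves finitely many entries per row and
    keeps the diagonal free for coding.\<close>
  define E where "E = {x \<in> B. psnd x < pfst x}"
  \<comment> \<open>Outside \<open>E\<close> the implication holds vacuously and the search ends at
    0; inside, halting is guaranteed.\<close>
  define stop where "stop = (\<lambda>x. LEAST s. x \<in> E \<longrightarrow> halts_by (psnd x) (pfst x) s)"
  define val where "val = (\<lambda>x. if x \<in> E then
    psnd (eval_steps (oracle_table {} (stop x)) (psnd x) (pfst x) (stop x)) else 0)"
  \<comment> \<open>The inner sum exceeds each certified output in row \<open>j\<close> or equals
    it, the \<open>Suc\<close> and the outer sum make the sequence strictly increasing, and the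
    factor 2 frees the parity for the diagonal bit.\<close>
  define a where "a = (\<lambda>k. 2 * (\<Sum>j<Suc k. Suc (\<Sum>e<j. val (prod_encode (j, e)))) +
    of_bool (prod_encode (k, k) \<in> B))"
  define kk where "kk = (\<lambda>n. LEAST k. n \<le> a k)"
  define Q where "Q = (\<lambda>n. {..prod_encode (n, n)})"

  have ex: "\<exists>s. x \<in> E \<longrightarrow> halts_by (psnd x) (pfst x) s" for x
    using halts[of "psnd x" "pfst x"] by (auto simp: E_def)
  have strict: "strict_mono a"
    by (auto simp: strict_mono_Suc_iff a_def)
  have less: "a i < a j \<longleftrightarrow> i < j" for i j using strict by (simp add: strict_mono_less)
  have ex_a: "\<exists>k. n \<le> a k" for n
    using strict_mono_imp_increasing[OF strict] by blast
  have kk: "n \<le> a (kk n)" for n unfolding kk_def by (rule LeastI_ex[OF ex_a])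
  have kk_le: "n \<le> a k \<Longrightarrow> kk n \<le> k" for n k unfolding kk_def by (rule Least_le)
  have range_a: "n \<in> range a \<longleftrightarrow> n = a (kk n)" for n
    using kk kk_le strict_mono_less_eq[OF strict] by (metis dual_order.antisym order_refl rangeE rangeI)

  have E: "decidable B (\<lambda>x. {x}) (\<lambda>x. x \<in> E)"
    unfolding E_def mem_Collect_eq by (intro computable_intros decidable_oracle)
  have stop: "computable B (\<lambda>x. {x}) stop"
    unfolding stop_def
  proof (rule computable_Least_within[OF _ ex])
    have "decidable B (\<lambda>z. {pfst z}) (\<lambda>z. pfst z \<in> E)"
      by (rule computable_compose[OF E]) (auto intro: computable_intros)
    then show "decidable B (\<lambda>z. {pfst z}) (\<lambda>z. pfst z \<in> E \<longrightarrow> halts_by (psnd (pfst z)) (pfst (pfst z)) (psnd z))"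
      by (intro computable_intros)
  qed simp
  have val: "computable B (\<lambda>x. {x}) val"
    unfolding val_def by (intro computable_intros E stop)
  have "computable B Q (\<lambda>j. \<Sum>e<j. val (prod_encode (j, e)))"
    by (rule computable_sum_within[where R = "\<lambda>z. {z}"])
      (use val in \<open>auto simp: Q_def prod_encode_le_diag intro: computable_intros\<close>)
  from computable_compose[OF this computable_psnd[OF computable_id] order_refl]
  have "computable B (\<lambda>z. Q (psnd z)) (\<lambda>z. Suc (\<Sum>e<psnd z. val (prod_encode (psnd z, e))))"
    by (rule computable_Suc)
  then have "computable B Q (\<lambda>k. \<Sum>j<Suc k. Suc (\<Sum>e<j. val (prod_encode (j, e))))"
    by (rule computable_sum_within)
      (auto simp: Q_def less_Suc_eq_le intro: computable_intros prod_encode_le_diag order_trans)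
  moreover have "decidable B Q (\<lambda>k. prod_encode (k, k) \<in> B)"
    by (rule computable_compose[OF decidable_oracle]) (auto simp: Q_def intro: computable_intros)
  ultimately have a: "computable B Q a"
    unfolding a_def by (intro computable_intros)
  \<comment> \<open>Finding \<open>kk n\<close> evaluates \<open>a\<close> only at indices up to
    \<open>kk n\<close>, so the query bound depends on \<open>kk n\<close> and not on the size of
    \<open>n\<close>.\<close>
  have kk_computable: "computable B (\<lambda>n. Q (kk n)) kk"
    unfolding kk_def
  proof (rule computable_Least_within[OF _ ex_a])
    show "decidable B (\<lambda>z. Q (psnd z)) (\<lambda>z. pfst z \<le> a (psnd z))"
      by (intro computable_intros computable_compose[OF a]) simp
  qed (auto simp: Q_def intro: prod_encode_le_diag order_trans)
  have "decidable B (\<lambda>n. Q (kk n)) (\<lambda>n. n = a (kk n))"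
    by (intro computable_intros computable_compose[OF a kk_computable]) simp
  then obtain p where p: "\<And>n. \<exists>qs. run B p n (of_bool (n \<in> range a)) qs \<and> set qs \<subseteq> Q (kk n)"
    unfolding computable_def range_a by blast
  have use: "use_function p B n \<le> Suc (prod_encode (kk n, kk n))" for n
  proof -
    have "q \<le> prod_encode (kk n, kk n)" if "q \<in> queries p B n" for q
    proof -
      obtain m y qs where m: "m < n" "run B p m y qs" "q \<in> set qs"
        using \<open>q \<in> queries p B n\<close> by (auto simp: queries_def)
      then have "q \<le> prod_encode (kk m, kk m)"
        using p[of m] run_deterministic unfolding Q_def by blast
      \<comment> \<open>Smaller inputs count towards the use as well; monotonicity of
        \<open>kk\<close> covers their queries.\<close>
      also have "kk m \<le> kk n" using kk_le[of m "kk n"] kk[of n] m(1) by simp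
      then have "prod_encode (kk m, kk m) \<le> prod_encode (kk n, kk n)"
        by (simp add: prod_encode_le_diag)
      finally show ?thesis .
    qed
    then show ?thesis by (auto simp: use_function_def finite_queries)
  qed

  have dominates: "\<forall>\<^sub>F j in sequentially. r j \<le> a j" if r: "recursive r" for r
  proof -
    obtain q where q: "\<And>n. \<exists>qs. run {} q n (r n) qs" using r by (auto simp: recursive_def)
    then have "total_prog q" unfolding total_prog_def by blast
    \<comment> \<open>Almost every row \<open>j\<close> certifies \<open>q\<close>, and
      \<open>prog_encode q < j\<close> puts this entry below the diagonal, so \<open>r j\<close> is
      one of the summands in \<open>a j\<close>.\<close>
    from total[OF this] eventually_gt_at_top[of "prog_encode q"] show ?thesis
    proof eventually_elim
      case (elim j)
      let ?x = "prod_encode (j, prog_encode q)"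
      have x: "?x \<in> E" using elim by (simp add: E_def)
      have "halts_by (prog_encode q) j (stop ?x)"
        using LeastI_ex[OF ex[of ?x]] x by (simp add: stop_def)
      then have "eval_steps (oracle_table {} (stop ?x)) (prog_encode q) j (stop ?x) = prod_encode (0, val ?x)"
        using x by (simp add: val_def) (metis prod.collapse prod_decode_inverse)
      from eval_oracle_table_sound[OF this] have "r j = val ?x"
        using q run_deterministic by metis
      also have "\<dots> \<le> (\<Sum>e<j. val (prod_encode (j, e)))"
        using elim by (intro member_le_sum) auto
      also have "\<dots> \<le> a j" by (simp add: a_def)
      finally show ?case by simp
    qed
  qed

  have "dominated_by (use_function p B) h" if h: "order_function h" for h
  proof -
    have rec: "recursive h" and mono: "mono h" and unb: "\<And>k. \<exists>n. k < h n"
      using h by (auto simp: order_function_def)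
    \<comment> \<open>\<open>r k\<close> is the point from which \<open>h\<close> exceeds the use
      bound belonging to index \<open>Suc k\<close>. The shift is needed because
      \<open>kk n = Suc K\<close> only gives \<open>a K < n\<close>; with
      \<open>r K \<le> a K\<close> this yields \<open>r K \<le> n\<close>.\<close>
    define r where "r = (\<lambda>k. LEAST n. Suc (prod_encode (Suc k, Suc k)) < h n)"
    have "computable {} (\<lambda>_. UNIV) (\<lambda>z. h (psnd z))"
      using computable_compose[OF rec[unfolded recursive_iff_computable] computable_psnd[OF computable_id]] by simp
    then have "recursive r"
      unfolding recursive_iff_computable r_def by (intro computable_intros unb)
    then obtain N where N: "\<And>j. j \<ge> N \<Longrightarrow> r j \<le> a j"
      using dominates by (auto simp: eventually_sequentially)
    have "use_function p B n \<le> h n" if n: "n > a N" for n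
    proof -
      have "N < kk n" using n kk[of n] less[of N "kk n"] by linarith
      then obtain K where K: "kk n = Suc K" "N \<le> K" by (cases "kk n") auto
      have "\<not> n \<le> a K" using kk_le[of n K] K(1) by auto
      then have "r K \<le> n" using N[OF K(2)] by simp
      have "Suc (prod_encode (Suc K, Suc K)) < h (r K)"
        unfolding r_def by (rule LeastI_ex[OF unb])
      also have "\<dots> \<le> h n" using mono \<open>r K \<le> n\<close> by (rule monoD)
      finally show ?thesis using use[of n] K(1) by simp
    qed
    then show ?thesis
      unfolding dominated_by_def eventually_sequentially by (meson Suc_le_lessD)
  qed
  moreover have "reduction p B (range a)" unfolding reduction_def using p by blast
  ultimately have "range a \<le>\<^sub>u\<^sub>T\<^sub>t\<^sub>u B" by (auto simp: uT_tu_le_def)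
  moreover have "{k. prod_encode (k, k) \<in> B} \<le>\<^sub>T range a"
  proof -
    have odd: "{k. prod_encode (k, k) \<in> B} = {k. odd (a k)}" by (simp add: a_def)
    show ?thesis
      unfolding odd turing_le_iff_decidable mem_Collect_eq
      by (rule decidable_odd[OF computable_from_range[OF strict]])
  qed
  ultimately show ?thesis by blast
qed

theorem corollary5p5:
  fixes d :: "nat set set"
  assumes "d \<in> turing_degrees" and "high d"
  shows "\<exists>A\<in>d. \<exists>B\<in>d. A \<le>\<^sub>u\<^sub>T\<^sub>t\<^sub>u B"
proof -
  obtain D where d: "d = turing_equiv `` {D}"
    using assms(1) by (auto simp: turing_degrees_def quotient_def)
  have mem: "X \<in> d \<longleftrightarrow> D \<le>\<^sub>T X \<and> X \<le>\<^sub>T D" for X by (auto simp: d turing_equiv_def)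
  have "D \<in> d" using equiv_turing_equiv by (auto simp: d equiv_def refl_on_def)
  with assms(2) obtain W where W: "W \<le>\<^sub>T D"
    and halts: "\<And>e j. prod_encode (e, j) \<in> W \<Longrightarrow> \<exists>s. halts_by e j s"
    and total: "\<And>p. total_prog p \<Longrightarrow> \<forall>\<^sub>F j in sequentially. prod_encode (prog_encode p, j) \<in> W"
    using high_enumerates_total unfolding high_def by metis
  \<comment> \<open>The diagonal holds \<open>D\<close>; elsewhere \<open>W\<close> is stored with
    coordinates exchanged, so that inputs of programs become row indices. Overwriting the diagonal
    loses nothing essential, since each program code is below almost all inputs.\<close>
  define B where "B = {x. if pfst x = psnd x then pfst x \<in> D else prod_encode (psnd x, pfst x) \<in> W}"
  have "decidable D (\<lambda>_. UNIV) (\<lambda>x. prod_encode (psnd x, pfst x) \<in> W)"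
    using W unfolding turing_le_iff_decidable by (rule computable_compose) (auto intro!: computable_intros)
  then have BD: "B \<le>\<^sub>T D"
    unfolding turing_le_iff_decidable B_def mem_Collect_eq by (intro computable_intros)
  have diag: "{k. prod_encode (k, k) \<in> B} = D" by (simp add: B_def)
  have "\<exists>s. halts_by e j s" if "e < j" "prod_encode (j, e) \<in> B" for e j
    using that halts by (auto simp: B_def)
  moreover have "\<forall>\<^sub>F j in sequentially. prod_encode (j, prog_encode p) \<in> B" if "total_prog p" for p
    using total[OF that] eventually_gt_at_top[of "prog_encode p"]
    by eventually_elim (simp add: B_def)
  ultimately obtain A where A: "A \<le>\<^sub>u\<^sub>T\<^sub>t\<^sub>u B" "D \<le>\<^sub>T A"
    using tiny_use[of B] unfolding diag by blast
  have "A \<le>\<^sub>T B" using A(1) unfolding uT_tu_le_def turing_le_def by blast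
  then have "A \<in> d" "B \<in> d" using A(2) BD turing_le_trans unfolding mem by blast+
  with A(1) show ?thesis by blast
qed

end
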